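(* For all integers $d\ge q\ge 2$ and $n_1,\dots,n_d\ge r\ge 1$ we have $$\mathrm{wsat}\big(K^q_{n_1,\dots,n_d},K^q(r;d)\big)=\sum_{I\in\binom{[d]}{q}}\ \prod_{i\in I}n_i\;-\;\sum_{I\in\binom{[d]}{\le q}}\ \prod_{i\in I}(n_i-r),$$ where the empty product equals $1$.
   Context: A $q$-graph is a $q$-uniform hypergraph, identified with its edge set. $\binom{[d]}{q}$ and $\binom{[d]}{\le q}$ denote the sets of subsets of $[d]=\{1,\dots,d\}$ of size exactly $q$ and at most $q$ (including the empty set), respectively. $K^q_{n_1,\dots,n_d}$ is the complete $d$-partite $q$-graph: its vertex set is a disjoint union of classes $N_1,\dots,N_d$ with $|N_i|=n_i$, and its edges are all $q$-subsets of the vertex set meeting each $N_i$ in at most one vertex. $K^q(r;d)$ denotes $K^q_{r,\dots,r}$ with $d$ classes each of size $r$. For $q$-graphs $F,H$ and a subgraph $G\subseteq F$ on the same vertex set as $F$, $G$ is weakly $H$-saturated in $F$ if the edges of $F\setminus G$ can be ordered as $e_1,\dots,e_k$ such that for every $i\in[k]$ the hypergraph $G\cup\{e_1,\dots,e_i\}$ contains an isomorphic copy of $H$ which contains the edge $e_i$ (there is no requirement on how this copy is placed relative to the classes of $F$). $\mathrm{wsat}(F,H)$ is the minimum number of edges in a weakly $H$-saturated subgraph of $F$. *)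

theory Defs
  imports Main
begin

text \<open>A \<open>q\<close>-graph is identified with its edge set, so hypergraphs have type \<open>'a set set\<close>.\<close>

definition vclass :: "(nat \<Rightarrow> nat) \<Rightarrow> nat \<Rightarrow> (nat \<times> nat) set" where
  "vclass n i = {i} \<times> {1..n i}"

definition complete_partite :: "nat \<Rightarrow> nat \<Rightarrow> (nat \<Rightarrow> nat) \<Rightarrow> (nat \<times> nat) set set" where
  "complete_partite q d n =
     {e. e \<subseteq> (\<Union>i\<in>{1..d}. vclass n i) \<and> card e = q \<and> (\<forall>i\<in>{1..d}. card (e \<inter> vclass n i) \<le> 1)}"

definition complete_balanced :: "nat \<Rightarrow> nat \<Rightarrow> nat \<Rightarrow> (nat \<times> nat) set set" where
  "complete_balanced q r d = complete_partite q d (\<lambda>_. r)"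

text \<open>The vertices of \<open>H\<close> are those covered by its edges; isolated vertices are not represented.\<close>

definition is_copy :: "'b set set \<Rightarrow> 'a set set \<Rightarrow> bool" where
  "is_copy H H' \<longleftrightarrow> (\<exists>f. inj_on f (\<Union>H) \<and> H' = (\<lambda>e. f ` e) ` H)"

definition weakly_saturated :: "'a set set \<Rightarrow> 'b set set \<Rightarrow> 'a set set \<Rightarrow> bool" where
  "weakly_saturated F H G \<longleftrightarrow>
     G \<subseteq> F \<and>
     (\<exists>es. distinct es \<and> set es = F - G \<and>
        (\<forall>i<length es. \<exists>H'. is_copy H H' \<and> H' \<subseteq> G \<union> set (take (Suc i) es) \<and> es ! i \<in> H'))"

text \<open>Meaningful for finite \<open>F\<close> only, since infinite sets have \<open>card\<close> \<open>0\<close>.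
  The minimum then exists, as \<open>F\<close> is weakly \<open>H\<close>-saturated in itself.\<close>

definition wsat :: "'a set set \<Rightarrow> 'b set set \<Rightarrow> nat" where
  "wsat F H = (LEAST m. \<exists>G. weakly_saturated F H G \<and> card G = m)"

end

theory Submission
  imports Defs "HOL-Computational_Algebra.Polynomial" "HOL-Library.FuncSet"
    "HOL-Library.Function_Algebras"
begin

text \<open>
  Write \<open>F\<close> for the host hypergraph, \<open>H\<close> for the balanced one, and call a set of vertices that meets
  every class at most once a partial transversal. The edges of \<open>F\<close> are the partial transversals of
  size \<open>q\<close>. Let \<open>B\<close> be the set of partial transversals of size at most \<open>q\<close> that use only the high
  vertices \<open>(i, x)\<close>, \<open>r < x \<le> n i\<close>. Both sums in the theorem count partial transversals
  (\<open>card_partial_transversals\<close>): the first is \<open>card F\<close>, the second is \<open>card B\<close>. So the claim is that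
  a weakly saturated \<open>G\<close> misses at most \<open>card B\<close> edges, and that some \<open>G\<close> misses exactly that many.

  Lower bound (\<open>card_complement_le\<close>). As \<open>q \<ge> 2\<close>, two vertices of \<open>H\<close> in different classes lie on a
  common edge, which forces a copy of \<open>H\<close> in \<open>F\<close> to send classes to classes: it consists of all
  \<open>q\<close>-element partial transversals of a system of \<open>r\<close>-subsets \<open>A i\<close> of the classes
  (\<open>copy_respects_classes\<close>). Give the vertex \<open>(i, x)\<close> the weight \<open>1 / (\<Prod>y\<in>A i - {x}. x - y)\<close> if
  \<open>x \<in> A i\<close> and \<open>0\<close> otherwise, and give an edge the product of the weights of its vertices. This
  product is nonzero exactly on the edges of the copy. Let the copy vary over the steps of the
  saturation process. The weight of an edge then becomes a function of the step, and the functions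
  of the added edges are triangular, hence linearly independent. By Lagrange interpolation the
  weights on class \<open>i\<close> satisfy \<open>r\<close> affine equations that do not depend on \<open>A i\<close>, so the weight of a
  low vertex is an affine function of the weights of the high vertices in its class
  (\<open>lagrange_weight_eliminate\<close>). Multiplying out, all these functions lie in the span of the
  \<open>card B\<close> products over members of \<open>B\<close> (\<open>product_in_span\<close>).

  Upper bound (\<open>exists_weakly_saturated\<close>). Extend each \<open>f \<in> B\<close> to an edge by vertices \<open>(i, r)\<close> in
  unused classes, and remove these edges from \<open>F\<close>. In the copy of \<open>H\<close> on the low vertices replace
  \<open>(i, r)\<close> by the vertex of \<open>f\<close> in class \<open>i\<close>, whenever there is one. This copy contains the edge of
  \<open>f\<close>, and the high vertices of its edges all lie in \<open>f\<close>. So its other removed edges come from proper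
  subsets of \<open>f\<close>, and the removed edges can be restored by increasing \<open>card f\<close>.
\<close>

section \<open>Partial transversals\<close>

text \<open>
  A vertex is a pair of its class and its name within the class, so that injectivity of \<open>fst\<close>
  says that no class is met twice.
\<close>

definition partial_transversals :: "'i set \<Rightarrow> ('i \<Rightarrow> 'b set) \<Rightarrow> ('i \<times> 'b) set set" where
  "partial_transversals K N = {e. e \<subseteq> Sigma K N \<and> inj_on fst e}"

lemma partial_transversalsI:
  "e \<subseteq> Sigma K N \<Longrightarrow> inj_on fst e \<Longrightarrow> e \<in> partial_transversals K N"
  by (simp add: partial_transversals_def)

lemma finite_partial_transversals:
  assumes "finite K" "\<And>i. i \<in> K \<Longrightarrow> finite (N i)"
  shows "finite (partial_transversals K N)"
  by (rule finite_subset[of _ "Pow (Sigma K N)"])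
    (use assms in \<open>auto simp: partial_transversals_def\<close>)

lemma finite_partial_transversal:
  assumes "e \<in> partial_transversals K N" "finite K"
  shows "finite e"
proof -
  have "fst ` e \<subseteq> K" "inj_on fst e"
    using assms(1) by (auto simp: partial_transversals_def)
  thus ?thesis using assms(2) finite_imageD finite_subset by blast
qed

text \<open>A partial transversal that meets exactly the classes in \<open>I\<close> is the graph of a choice function on \<open>I\<close>.\<close>

lemma card_partial_transversals_over:
  fixes N :: "'i \<Rightarrow> 'b set"
  assumes "finite I"
  shows "card {e. e \<subseteq> Sigma I N \<and> inj_on fst e \<and> fst ` e = I} = (\<Prod>i\<in>I. card (N i))"
proof -
  let ?graph = "\<lambda>g. (\<lambda>i. (i, g i)) ` I"
  have "bij_betw ?graph (PiE I N) {e. e \<subseteq> Sigma I N \<and> inj_on fst e \<and> fst ` e = I}"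
  proof (rule bij_betwI')
    fix g h assume "g \<in> PiE I N" "h \<in> PiE I N"
    thus "(?graph g = ?graph h) = (g = h)"
      by (auto intro!: PiE_ext[of g I N h])
  next
    fix g assume "g \<in> PiE I N"
    thus "?graph g \<in> {e. e \<subseteq> Sigma I N \<and> inj_on fst e \<and> fst ` e = I}"
      by (auto simp: inj_on_def image_image)
  next
    fix e assume e: "e \<in> {e. e \<subseteq> Sigma I N \<and> inj_on fst e \<and> fst ` e = I}"
    define g where "g = (\<lambda>i\<in>I. snd (inv_into e fst i))"
    have *: "(i, g i) \<in> e" if "i \<in> I" for i
    proof -
      have "i \<in> fst ` e" using that e by auto
      hence "inv_into e fst i \<in> e" "fst (inv_into e fst i) = i"
        by (auto intro: inv_into_into f_inv_into_f)
      thus ?thesis using that by (metis g_def prod.collapse restrict_apply')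
    qed
    have "p \<in> ?graph g" if "p \<in> e" for p
    proof -
      have "fst p \<in> I" using that e by auto
      hence "p = (fst p, g (fst p))"
        using * that e by (metis (mono_tags, lifting) fst_conv inj_onD mem_Collect_eq)
      thus ?thesis using \<open>fst p \<in> I\<close> by blast
    qed
    hence "e = ?graph g" using * by auto
    moreover have "g \<in> PiE I N"
      using * e by (auto simp: g_def)
    ultimately show "\<exists>g\<in>PiE I N. e = ?graph g" by blast
  qed
  thus ?thesis
    using assms by (simp add: bij_betw_same_card[symmetric] card_PiE)
qed

lemma card_partial_transversals:
  assumes "finite K" "\<And>i. i \<in> K \<Longrightarrow> finite (N i)"
  shows "card {e \<in> partial_transversals K N. P (card e)} =
    (\<Sum>I | I \<subseteq> K \<and> P (card I). \<Prod>i\<in>I. card (N i))"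
proof -
  let ?over = "\<lambda>I. {e. e \<subseteq> Sigma I N \<and> inj_on fst e \<and> fst ` e = I}"
  let ?Is = "{I. I \<subseteq> K \<and> P (card I)}"
  have eq: "{e \<in> partial_transversals K N. P (card e)} = (\<Union>I\<in>?Is. ?over I)"
  proof -
    have "e \<in> partial_transversals K N \<and> P (card e) \<longleftrightarrow> (\<exists>I\<in>?Is. e \<in> ?over I)" for e
    proof -
      have "e \<subseteq> Sigma K N \<longleftrightarrow> fst ` e \<subseteq> K \<and> e \<subseteq> Sigma (fst ` e) N"
        by force
      moreover have "inj_on fst e \<Longrightarrow> card (fst ` e) = card e"
        by (rule card_image)
      ultimately show ?thesis
        by (auto simp: partial_transversals_def)
    qed
    thus ?thesis by blast
  qed
  have fin: "finite (?over I)" if "I \<subseteq> K" for I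
    by (rule finite_subset[OF _ finite_partial_transversals[OF assms]])
      (use that in \<open>auto simp: partial_transversals_def\<close>)
  have "card (\<Union>I\<in>?Is. ?over I) = (\<Sum>I\<in>?Is. card (?over I))"
    by (rule card_UN_disjoint) (use assms(1) fin in auto)
  also have "\<dots> = (\<Sum>I\<in>?Is. \<Prod>i\<in>I. card (N i))"
    by (rule sum.cong) (use assms(1) in \<open>auto simp: card_partial_transversals_over finite_subset\<close>)
  finally show ?thesis by (simp only: eq)
qed

lemma partial_transversal_remove:
  "e \<in> partial_transversals K N \<Longrightarrow> e - X \<in> partial_transversals K N"
  by (auto simp: partial_transversals_def intro: inj_on_diff)

lemma partial_transversal_unique:
  "e \<in> partial_transversals K N \<Longrightarrow> p \<in> e \<Longrightarrow> p' \<in> e \<Longrightarrow> fst p = fst p' \<Longrightarrow> p = p'"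
  by (simp add: partial_transversals_def inj_on_def)

lemma partial_transversal_exchange:
  assumes "e \<in> partial_transversals K N" "(i, x) \<in> e" "y \<in> N i"
  shows "insert (i, y) (e - {(i, x)}) \<in> partial_transversals K N"
proof -
  have e: "e \<subseteq> Sigma K N" "inj_on fst e"
    using assms(1) by (auto simp: partial_transversals_def)
  have "i \<notin> fst ` (e - {(i, x)})"
    using partial_transversal_unique[OF assms(1) _ assms(2)] by fastforce
  hence "inj_on fst (insert (i, y) (e - {(i, x)}))"
    using e(2) by (simp add: inj_on_insert inj_on_diff image_iff)
  moreover have "insert (i, y) (e - {(i, x)}) \<subseteq> Sigma K N"
    using e(1) assms(2,3) by auto
  ultimately show ?thesis by (intro partial_transversalsI)
qed

lemma complete_partite_eq:
  "complete_partite q d n =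
    {e \<in> partial_transversals {1..d} (\<lambda>i. {1..n i}). card e = q}"
proof -
  have inj: "(\<forall>i\<in>{1..d}. card (e \<inter> vclass n i) \<le> 1) \<longleftrightarrow> inj_on fst e"
    if e: "e \<subseteq> (SIGMA i:{1..d}. {1..n i})" for e
  proof -
    have "finite e" by (rule finite_subset[OF e]) auto
    have vclass: "e \<inter> vclass n i = {p \<in> e. fst p = i}" for i
      using e by (auto simp: vclass_def)
    have "card (e \<inter> vclass n i) \<le> 1 \<longleftrightarrow>
        (\<forall>p\<in>e. \<forall>p'\<in>e. fst p = i \<longrightarrow> fst p' = i \<longrightarrow> p = p')" for i
    proof -
      have "finite (e \<inter> vclass n i)" using \<open>finite e\<close> by simp
      from card_le_Suc0_iff_eq[OF this] show ?thesis unfolding vclass One_nat_def by blast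
    qed
    moreover have "fst p \<in> {1..d}" if "p \<in> e" for p using that e by auto
    ultimately show ?thesis unfolding inj_on_def by blast
  qed
  have V: "(\<Union>i\<in>{1..d}. vclass n i) = (SIGMA i:{1..d}. {1..n i})"
    by (auto simp: vclass_def)
  show ?thesis
    unfolding complete_partite_def partial_transversals_def V
    by (rule set_eqI) (simp only: mem_Collect_eq inj conj_ac cong: conj_cong)
qed

section \<open>Copies of the balanced complete hypergraph\<close>

text \<open>This is where \<open>q \<ge> 2\<close> enters: within \<open>H\<close>, adjacency separates the classes.\<close>

lemma edge_through_two:
  assumes "2 \<le> q" "q \<le> d" "u \<in> {1..d} \<times> {1..r}" "v \<in> {1..d} \<times> {1..r}" "fst u \<noteq> fst v"
  obtains e where "e \<in> complete_balanced q r d" "u \<in> e" "v \<in> e"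
proof -
  have "q - 2 \<le> card ({1..d} - {fst u, fst v})"
    using assms by (subst card_Diff_subset) auto
  then obtain J where J: "J \<subseteq> {1..d} - {fst u, fst v}" "card J = q - 2" "finite J"
    by (metis obtain_subset_with_card_n)
  let ?e = "insert u (insert v ((\<lambda>i. (i, 1)) ` J))"
  have "card ((\<lambda>i. (i, 1::nat)) ` J) = q - 2"
    using J by (subst card_image) (auto simp: inj_on_def)
  moreover have "u \<notin> (\<lambda>i. (i, 1)) ` J" "v \<notin> (\<lambda>i. (i, 1)) ` J" "u \<noteq> v"
    using J assms by auto
  ultimately have "card ?e = q" using assms J by simp
  moreover have "?e \<in> partial_transversals {1..d} (\<lambda>_. {1..r})"
    using J assms by (auto simp: partial_transversals_def inj_on_def)
  ultimately show ?thesis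
    using that[of ?e] by (auto simp: complete_balanced_def complete_partite_eq)
qed

lemma Union_complete_balanced:
  assumes "2 \<le> q" "q \<le> d"
  shows "\<Union>(complete_balanced q r d) = {1..d} \<times> {1..r}"
proof
  show "\<Union>(complete_balanced q r d) \<subseteq> {1..d} \<times> {1..r}"
    by (auto simp: complete_balanced_def complete_partite_eq partial_transversals_def)
  show "{1..d} \<times> {1..r} \<subseteq> \<Union>(complete_balanced q r d)"
  proof
    fix u assume u: "u \<in> {1..d} \<times> {1..r}"
    define j :: nat where "j = (if fst u = 1 then 2 else 1)"
    have "(j, 1) \<in> {1..d} \<times> {1..r}" "fst u \<noteq> fst (j, 1::nat)"
      using u assms by (auto simp: j_def)
    from edge_through_two[OF assms u this] show "u \<in> \<Union>(complete_balanced q r d)"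
      by blast
  qed
qed

text \<open>
  Vertices of different classes of \<open>H\<close> share an edge, so their images lie in different classes of
  \<open>F\<close>. Both hypergraphs have \<open>d\<close> classes, so by counting each class of \<open>H\<close> goes into a single class
  of \<open>F\<close>, and the classes are permuted.
\<close>

lemma copy_respects_classes:
  assumes "2 \<le> q" "q \<le> d" "1 \<le> r"
    and copy: "is_copy (complete_balanced q r d) H'" and sub: "H' \<subseteq> complete_partite q d n"
  obtains A where "\<And>i. i \<in> {1..d} \<Longrightarrow> A i \<subseteq> {1..n i} \<and> card (A i) = r"
    and "H' = {e \<in> partial_transversals {1..d} A. card e = q}"
proof -
  let ?H = "complete_balanced q r d"
  define V where "V = {1..d} \<times> {1..r}"
  have UnH: "\<Union>?H = V" using Union_complete_balanced[OF assms(1,2)] by (simp add: V_def)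
  have edgeH: "e \<in> ?H \<longleftrightarrow> e \<subseteq> V \<and> inj_on fst e \<and> card e = q" for e
    by (simp add: complete_balanced_def complete_partite_eq partial_transversals_def V_def)
  have edgeF: "e \<subseteq> (SIGMA i:{1..d}. {1..n i})" "inj_on fst e" "card e = q" if "e \<in> H'" for e
    using subsetD[OF sub that] by (simp_all add: complete_partite_eq partial_transversals_def)
  obtain f where f: "inj_on f V" and H': "H' = (\<lambda>e. f ` e) ` ?H"
    using copy unfolding is_copy_def UnH by blast
  have range: "fst (f u) \<in> {1..d}" "snd (f u) \<in> {1..n (fst (f u))}" if u: "u \<in> V" for u
  proof -
    obtain e where "e \<in> ?H" "u \<in> e" using u UnH by blast
    hence "f u \<in> (SIGMA i:{1..d}. {1..n i})"
      using edgeF(1)[of "f ` e"] unfolding H' by blast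
    thus "fst (f u) \<in> {1..d}" "snd (f u) \<in> {1..n (fst (f u))}" by auto
  qed
  have sep: "fst (f u) \<noteq> fst (f v)" if uv: "u \<in> V" "v \<in> V" "fst u \<noteq> fst v" for u v
  proof
    assume eq: "fst (f u) = fst (f v)"
    obtain e where e: "e \<in> ?H" "u \<in> e" "v \<in> e"
      using edge_through_two[OF assms(1,2) uv[unfolded V_def]] by blast
    have "inj_on fst (f ` e)" using edgeF(2) e(1) unfolding H' by blast
    from inj_onD[OF this eq] e have "f u = f v" by blast
    from inj_onD[OF f this] uv show False by blast
  qed
  define \<sigma> where "\<sigma> i = fst (f (i, 1))" for i
  have one: "(i, 1) \<in> V" if "i \<in> {1..d}" for i using that assms(3) by (simp add: V_def)
  have "\<sigma> ` {1..d} \<subseteq> {1..d}"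
    using range(1)[OF one] unfolding \<sigma>_def by blast
  moreover have inj\<sigma>: "inj_on \<sigma> {1..d}"
  proof (rule inj_onI)
    fix i j assume "i \<in> {1..d}" "j \<in> {1..d}" "\<sigma> i = \<sigma> j"
    thus "i = j" using sep[OF one one, of i j] by (metis \<sigma>_def fst_conv)
  qed
  ultimately have surj: "\<sigma> ` {1..d} = {1..d}"
    by (simp add: endo_inj_surj)
  have fst_f: "fst (f u) = \<sigma> (fst u)" if u: "u \<in> V" for u
  proof -
    have "fst (f u) \<in> \<sigma> ` {1..d}" using range(1)[OF u] surj by simp
    then obtain j where j: "j \<in> {1..d}" "fst (f u) = fst (f (j, 1))"
      unfolding \<sigma>_def by blast
    hence "fst u = j" using sep[OF u one[OF j(1)]] by auto
    thus ?thesis using j by (simp add: \<sigma>_def)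
  qed
  \<comment> \<open>The trace of the image of the embedding on class \<open>j\<close>; it comes from the single class
    that \<open>\<sigma>\<close> sends to \<open>j\<close>.\<close>
  define A where "A j = {x. (j, x) \<in> f ` V}" for j
  have fV: "Sigma {1..d} A = f ` V"
  proof (rule set_eqI)
    fix p
    have "fst p \<in> {1..d}" if "p \<in> f ` V" using that range(1) by blast
    thus "p \<in> Sigma {1..d} A \<longleftrightarrow> p \<in> f ` V" by (cases p) (auto simp: A_def)
  qed
  have "A j \<subseteq> {1..n j} \<and> card (A j) = r" if j: "j \<in> {1..d}" for j
  proof
    show "A j \<subseteq> {1..n j}"
    proof
      fix x assume "x \<in> A j"
      then obtain u where u: "u \<in> V" "(j, x) = f u" unfolding A_def by blast
      show "x \<in> {1..n j}" using range(2)[OF u(1)] by (simp flip: u(2))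
    qed
    obtain i where i: "i \<in> {1..d}" "j = \<sigma> i" using j surj by blast
    have "{j} \<times> A j = f ` ({i} \<times> {1..r})"
    proof
      show "{j} \<times> A j \<subseteq> f ` ({i} \<times> {1..r})"
      proof
        fix p assume "p \<in> {j} \<times> A j"
        hence "p \<in> f ` V" "fst p = j" by (cases p; simp add: A_def)+
        then obtain u where u: "u \<in> V" "p = f u" "fst p = j" by blast
        hence "fst u \<in> {1..d}" "snd u \<in> {1..r}" "\<sigma> (fst u) = \<sigma> i"
          using fst_f[OF u(1)] i by (auto simp: V_def)
        hence "fst u = i" using inj\<sigma> i(1) by (meson inj_onD)
        hence "u \<in> {i} \<times> {1..r}" using \<open>snd u \<in> {1..r}\<close> by (simp add: mem_Times_iff)
        thus "p \<in> f ` ({i} \<times> {1..r})" using u(2) by blast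
      qed
      show "f ` ({i} \<times> {1..r}) \<subseteq> {j} \<times> A j"
      proof
        fix p assume "p \<in> f ` ({i} \<times> {1..r})"
        then obtain u where u: "u \<in> {i} \<times> {1..r}" "p = f u" by blast
        hence uV: "u \<in> V" "fst u = i" using i by (auto simp: V_def)
        hence "fst p = j" using fst_f u(2) i by simp
        moreover have "p \<in> f ` V" using uV u by blast
        ultimately show "p \<in> {j} \<times> A j" by (cases p) (simp add: A_def)
      qed
    qed
    moreover have "card (f ` ({i} \<times> {1..r})) = r"
    proof -
      have "{i} \<times> {1..r} \<subseteq> V" using i by (auto simp: V_def)
      from card_image[OF inj_on_subset[OF f this]] show ?thesis
        by (simp add: card_cartesian_product)
    qed
    ultimately show "card (A j) = r" by (metis card_cartesian_product_singleton)
  qed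
  moreover have "H' = {e \<in> partial_transversals {1..d} A. card e = q}"
  proof
    show "H' \<subseteq> {e \<in> partial_transversals {1..d} A. card e = q}"
    proof
      fix e' assume e': "e' \<in> H'"
      then obtain e where e: "e \<in> ?H" "e' = f ` e" unfolding H' by blast
      have "e' \<subseteq> Sigma {1..d} A" using e edgeH unfolding fV by blast
      thus "e' \<in> {e \<in> partial_transversals {1..d} A. card e = q}"
        using edgeF[OF e'] by (simp add: partial_transversals_def)
    qed
    show "{e \<in> partial_transversals {1..d} A. card e = q} \<subseteq> H'"
    proof
      fix e' assume "e' \<in> {e \<in> partial_transversals {1..d} A. card e = q}"
      hence e': "e' \<subseteq> Sigma {1..d} A" "inj_on fst e'" "card e' = q"
        by (simp_all add: partial_transversals_def)
      obtain e where e: "e \<subseteq> V" "e' = f ` e"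
        using e'(1) unfolding fV by (rule subset_imageE)
      have "card e = q" using e e' f by (metis card_image inj_on_subset)
      moreover have "inj_on fst e"
      proof (rule inj_onI)
        fix u v assume uv: "u \<in> e" "v \<in> e" "fst u = fst v"
        hence "fst (f u) = fst (f v)" using fst_f e by (metis subsetD)
        from inj_onD[OF e'(2) this] e uv have "f u = f v" by blast
        from inj_onD[OF f this] e uv show "u = v" by blast
      qed
      ultimately have "e \<in> ?H" using e edgeH by blast
      thus "e' \<in> H'" using e H' by blast
    qed
  qed
  ultimately show ?thesis by (rule that)
qed

section \<open>Lagrange weights\<close>

text \<open>
  For \<open>x \<in> A\<close> this is the leading coefficient of the polynomial of degree less than \<open>card A\<close> that is
  \<open>1\<close> at \<open>x\<close> and \<open>0\<close> on the rest of \<open>A\<close>.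
\<close>

definition lagrange_weight :: "'a::field set \<Rightarrow> 'a \<Rightarrow> 'a" where
  "lagrange_weight A x = (if x \<in> A then 1 / (\<Prod>y\<in>A - {x}. x - y) else 0)"

lemma lagrange_weight_eq_0_iff:
  "finite A \<Longrightarrow> lagrange_weight A x = 0 \<longleftrightarrow> x \<notin> A"
  by (auto simp: lagrange_weight_def)

lemma monic_prod_linear:
  assumes "finite S"
  shows "degree (\<Prod>s\<in>S. [:- s, 1::'a::field:]) = card S"
    "coeff (\<Prod>s\<in>S. [:- s, 1::'a:]) (card S) = 1"
proof -
  show deg: "degree (\<Prod>s\<in>S. [:- s, 1::'a:]) = card S"
    by (subst degree_prod_eq_sum_degree) auto
  have "lead_coeff (\<Prod>s\<in>S. [:- s, 1::'a:]) = 1"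
    by (simp add: lead_coeff_prod)
  thus "coeff (\<Prod>s\<in>S. [:- s, 1::'a:]) (card S) = 1" by (simp add: deg)
qed

text \<open>
  The monic polynomial with root set \<open>S\<close> has degree below \<open>card A\<close>, so it equals its Lagrange
  interpolation on \<open>A\<close>; compare the leading coefficients.
\<close>

lemma sum_lagrange_weight:
  fixes A S :: "'a::field set"
  assumes "finite A" "finite S" "card A = Suc (card S)"
  shows "(\<Sum>x\<in>A. lagrange_weight A x * (\<Prod>s\<in>S. x - s)) = 1"
proof -
  define P where "P = (\<Prod>s\<in>S. [:- s, 1:])"
  define B where "B x = (\<Prod>y\<in>A - {x}. [:- y, 1:])" for x :: 'a
  define Q where "Q = (\<Sum>x\<in>A. smult (lagrange_weight A x * poly P x) (B x))"
  have cardA: "card (A - {x}) = card S" if "x \<in> A" for x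
    using that assms by simp
  have degB: "degree (B x) = card S" and coeffB: "coeff (B x) (card S) = 1" if "x \<in> A" for x
    using monic_prod_linear[of "A - {x}"] assms that by (auto simp: B_def cardA)
  have "P = Q"
  proof (rule poly_eqI_degree)
    fix a assume a: "a \<in> A"
    have "poly Q a = (\<Sum>x\<in>A. if x = a then poly P a else 0)"
      unfolding Q_def poly_sum
    proof (rule sum.cong)
      fix x assume x: "x \<in> A"
      show "poly (smult (lagrange_weight A x * poly P x) (B x)) a = (if x = a then poly P a else 0)"
        using x a assms(1) by (auto simp: B_def poly_prod lagrange_weight_def)
    qed simp
    also have "\<dots> = poly P a" using a assms(1) by simp
    finally show "poly P a = poly Q a" ..
  next
    show "degree P < card A" using assms by (simp add: P_def monic_prod_linear)
    have "degree Q \<le> card S"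
      unfolding Q_def
      by (rule degree_sum_le) (use assms degB degree_smult_le in \<open>auto simp: le_trans\<close>)
    thus "degree Q < card A" using assms by simp
  qed
  hence "coeff Q (card S) = 1"
    using monic_prod_linear(2)[OF assms(2)] by (simp add: P_def)
  moreover have "coeff Q (card S) = (\<Sum>x\<in>A. lagrange_weight A x * poly P x)"
    unfolding Q_def coeff_sum by (rule sum.cong) (auto simp: coeffB)
  ultimately show ?thesis by (simp add: P_def poly_prod)
qed

text \<open>
  The coefficients of this affine relation depend on \<open>L\<close> and \<open>U\<close> only, not on \<open>A\<close>. It is
  \<open>sum_lagrange_weight\<close> for \<open>S = L - {x}\<close>: in the sum over \<open>U\<close> the points of \<open>S\<close> contribute nothing, which leaves \<open>x\<close>
  and the points outside \<open>L\<close>.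
\<close>

lemma lagrange_weight_eliminate:
  fixes A L U :: "'a::field set"
  assumes "finite U" "A \<subseteq> U" "L \<subseteq> U" "card A = card L" "x \<in> L"
  shows "lagrange_weight A x = lagrange_weight L x +
    (\<Sum>y\<in>U - L. - (lagrange_weight L x * (\<Prod>z\<in>L - {x}. y - z)) * lagrange_weight A y)"
proof -
  let ?P = "\<lambda>y. \<Prod>z\<in>L - {x}. y - z"
  have fin: "finite A" "finite L" using assms by (auto intro: finite_subset)
  have L: "lagrange_weight L x * ?P x = 1"
    using assms fin by (auto simp: lagrange_weight_def)
  have "1 = (\<Sum>y\<in>A. lagrange_weight A y * ?P y)"
    using sum_lagrange_weight[of A "L - {x}"] assms fin card_Suc_Diff1[OF fin(2) assms(5)] by simp
  also have "\<dots> = (\<Sum>y\<in>U. lagrange_weight A y * ?P y)"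
    by (rule sum.mono_neutral_left) (use assms in \<open>auto simp: lagrange_weight_def\<close>)
  also have "\<dots> = (\<Sum>y\<in>insert x (U - L). lagrange_weight A y * ?P y)"
    by (rule sum.mono_neutral_right) (use assms fin in auto)
  also have "\<dots> = lagrange_weight A x * ?P x + (\<Sum>y\<in>U - L. lagrange_weight A y * ?P y)"
    using assms by simp
  finally have "lagrange_weight L x = lagrange_weight L x * (lagrange_weight A x * ?P x)
      + lagrange_weight L x * (\<Sum>y\<in>U - L. lagrange_weight A y * ?P y)"
    by (metis (no_types) distrib_left mult.right_neutral)
  also have "lagrange_weight L x * (lagrange_weight A x * ?P x) = lagrange_weight A x"
    using L by (simp add: mult.left_commute)
  finally show ?thesis
    by (simp add: sum_distrib_left sum_negf algebra_simps)
qed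

section \<open>The lower bound\<close>

interpretation fun_space: vector_space "\<lambda>(c::'f::field) (g::'t \<Rightarrow> 'f) t. c * g t"
  by unfold_locales (auto simp: fun_eq_iff algebra_simps)

lemma sum_fun_apply: "(\<Sum>y\<in>Y. g y) t = (\<Sum>y\<in>Y. g y t)"
  by (induction Y rule: infinite_finite_induct) auto

text \<open>
  All successors of \<open>z j\<close> vanish at \<open>j\<close>, where \<open>z j\<close> does not, so \<open>z j\<close> is not in their span. Hence
  the \<open>k\<close> functions are independent.
\<close>

lemma triangular_card_le:
  fixes z :: "nat \<Rightarrow> nat \<Rightarrow> 'f::field"
  assumes "finite B" "\<And>j. j < k \<Longrightarrow> z j \<in> fun_space.span B"
    and "\<And>j t. t < j \<Longrightarrow> j < k \<Longrightarrow> z j t = 0" "\<And>j. j < k \<Longrightarrow> z j j \<noteq> 0"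
  shows "k \<le> card B"
proof -
  have "fun_space.independent (z ` {j..<k}) \<and> card (z ` {j..<k}) = k - j" if "j \<le> k" for j
    using that
  proof (induction rule: inc_induct)
    case base
    show ?case by (simp add: fun_space.independent_empty)
  next
    case (step j)
    have "fun_space.span (z ` {Suc j..<k}) \<subseteq> {g. g j = 0}"
      by (rule fun_space.span_minimal)
        (use assms(3) in \<open>auto simp: fun_space.subspace_def\<close>)
    hence notin: "z j \<notin> fun_space.span (z ` {Suc j..<k})"
      using assms(4)[OF step.hyps(2)] by auto
    hence notin': "z j \<notin> z ` {Suc j..<k}"
      using fun_space.span_base by blast
    have "{j..<k} = insert j {Suc j..<k}"
      using step.hyps by auto
    hence "z ` {j..<k} = insert (z j) (z ` {Suc j..<k})" by simp
    thus ?case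
      using notin notin' step by (simp add: fun_space.independent_insert)
  qed
  from this[of 0] have "fun_space.independent (z ` {0..<k})" "card (z ` {0..<k}) = k" by auto
  moreover have "z ` {0..<k} \<subseteq> fun_space.span B" using assms(2) by auto
  ultimately show ?thesis
    using fun_space.independent_span_bound[OF assms(1)] by metis
qed

text \<open>
  Here \<open>v t p\<close> is the weight of the vertex \<open>p\<close> at the sample \<open>t\<close>. Substituting the affine relation for
  one vertex outside \<open>M\<close> either deletes that vertex or moves it into \<open>M\<close> within its class. Both
  operations preserve partial transversals, do not increase the size and lower the number of
  vertices outside \<open>M\<close>, which drives the induction.
\<close>

lemma product_in_span:
  fixes v :: "'t \<Rightarrow> 'i \<times> 'b \<Rightarrow> 'f::field"
  assumes "finite K" "\<And>i. i \<in> K \<Longrightarrow> finite (M i)"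
    and affine: "\<And>i x. i \<in> K \<Longrightarrow> x \<in> L i \<Longrightarrow>
      \<exists>a b. \<forall>t. v t (i, x) = a + (\<Sum>y\<in>M i. b y * v t (i, y))"
    and "e \<in> partial_transversals K (\<lambda>i. L i \<union> M i)" "card e \<le> q"
  shows "(\<lambda>t. \<Prod>p\<in>e. v t p) \<in>
    fun_space.span ((\<lambda>f t. \<Prod>p\<in>f. v t p) ` {f \<in> partial_transversals K M. card f \<le> q})"
  using assms(4,5)
proof (induction "card (e - Sigma K M)" arbitrary: e rule: less_induct)
  case less
  let ?Z = "\<lambda>e t. \<Prod>p\<in>e. v t p"
  let ?S = "fun_space.span (?Z ` {f \<in> partial_transversals K M. card f \<le> q})"
  have fin: "finite e" using less.prems(1) assms(1) by (rule finite_partial_transversal)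
  show ?case
  proof (cases "e \<subseteq> Sigma K M")
    case True
    hence "e \<in> partial_transversals K M"
      using less.prems by (auto simp: partial_transversals_def)
    thus ?thesis using less.prems by (intro fun_space.span_base) auto
  next
    case False
    then obtain i x where p: "(i, x) \<in> e" "(i, x) \<notin> Sigma K M" by auto
    hence i: "i \<in> K" and x: "x \<in> L i" using less.prems by (auto simp: partial_transversals_def)
    from affine[OF i x] obtain a b where
      ab: "\<And>t. v t (i, x) = a + (\<Sum>y\<in>M i. b y * v t (i, y))" by blast
    define e0 where "e0 = e - {(i, x)}"
    have fresh: "(i, y) \<notin> e0" for y
      using partial_transversal_unique[OF less.prems(1) p(1), of "(i, y)"] by (auto simp: e0_def)
    have fin0: "finite e0" using fin by (simp add: e0_def)
    have card0: "Suc (card e0) = card e"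
      unfolding e0_def by (rule card_Suc_Diff1[OF fin p(1)])
    have smaller: "card (e0 - Sigma K M) < card (e - Sigma K M)"
      using p fin by (intro psubset_card_mono) (auto simp: e0_def)
    have "?Z e0 \<in> ?S"
    proof (rule less.hyps)
      show "e0 \<in> partial_transversals K (\<lambda>i. L i \<union> M i)"
        unfolding e0_def by (rule partial_transversal_remove[OF less.prems(1)])
      show "card e0 \<le> q" using less.prems(2) card0 by simp
    qed (rule smaller)
    moreover have "?Z (insert (i, y) e0) \<in> ?S" if y: "y \<in> M i" for y
    proof (rule less.hyps)
      show "card (insert (i, y) e0 - Sigma K M) < card (e - Sigma K M)"
        using smaller y i by simp
      show "insert (i, y) e0 \<in> partial_transversals K (\<lambda>i. L i \<union> M i)"
        unfolding e0_def using less.prems(1) p(1) y by (intro partial_transversal_exchange) auto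
      show "card (insert (i, y) e0) \<le> q" using less.prems card0 fresh fin0 by simp
    qed
    ultimately have "(\<lambda>t. a * ?Z e0 t) + (\<Sum>y\<in>M i. (\<lambda>t. b y * ?Z (insert (i, y) e0) t)) \<in> ?S"
      by (rule fun_space.span_add[OF fun_space.span_scale
            fun_space.span_sum[OF fun_space.span_scale]])
    also have "(\<lambda>t. a * ?Z e0 t) + (\<Sum>y\<in>M i. (\<lambda>t. b y * ?Z (insert (i, y) e0) t)) = ?Z e"
    proof
      fix t
      have "?Z e t = v t (i, x) * ?Z e0 t"
        unfolding e0_def by (rule prod.remove[OF fin p(1)])
      also have "\<dots> = a * ?Z e0 t + (\<Sum>y\<in>M i. b y * (v t (i, y) * ?Z e0 t))"
        by (simp add: ab distrib_right sum_distrib_right mult.assoc)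
      also have "\<dots> = a * ?Z e0 t + (\<Sum>y\<in>M i. b y * ?Z (insert (i, y) e0) t)"
        using fresh fin0 by simp
      finally show "((\<lambda>t. a * ?Z e0 t) + (\<Sum>y\<in>M i. (\<lambda>t. b y * ?Z (insert (i, y) e0) t))) t = ?Z e t"
        by (simp add: sum_fun_apply)
    qed
    finally show ?thesis .
  qed
qed

text \<open>
  The samples are the steps of the saturation process, and \<open>A t\<close> describes the copy used at step
  \<open>t\<close>. The copy of step \<open>t\<close> contains the edge added then but none added later, which makes the
  weights triangular.
\<close>

lemma card_complement_le:
  assumes "2 \<le> q" "q \<le> d" "1 \<le> r" "\<forall>i\<in>{1..d}. r \<le> n i"
    and sat: "weakly_saturated (complete_partite q d n) (complete_balanced q r d) G"
  shows "card (complete_partite q d n - G) \<le>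
    card {f \<in> partial_transversals {1..d} (\<lambda>i. {r<..n i}). card f \<le> q}"
proof -
  let ?F = "complete_partite q d n" and ?H = "complete_balanced q r d"
  let ?B = "{f \<in> partial_transversals {1..d} (\<lambda>i. {r<..n i}). card f \<le> q}"
  obtain es where es: "distinct es" "set es = ?F - G"
    and step: "\<And>t. t < length es \<Longrightarrow>
      \<exists>H'. is_copy ?H H' \<and> H' \<subseteq> G \<union> set (take (Suc t) es) \<and> es ! t \<in> H'"
    and "G \<subseteq> ?F"
    using sat by (auto simp: weakly_saturated_def)
  define valid where "valid A \<longleftrightarrow> (\<forall>i\<in>{1..d}. A i \<subseteq> {1..n i} \<and> card (A i) = r)" for A
  \<comment> \<open>The affine relations must hold at every sample, so the sets \<open>A t\<close> are also chosen for \<open>t\<close>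
    beyond the last step; any \<open>r\<close>-subsets of the classes will do there.\<close>
  have "\<exists>A. valid A \<and> (t < length es \<longrightarrow> es ! t \<subseteq> Sigma {1..d} A \<and>
      (\<forall>e \<in> ?F. e \<subseteq> Sigma {1..d} A \<longrightarrow> e \<in> G \<union> set (take (Suc t) es)))" for t
  proof (cases "t < length es")
    case True
    from step[OF this] obtain H' where H': "is_copy ?H H'"
      "H' \<subseteq> G \<union> set (take (Suc t) es)" "es ! t \<in> H'" by blast
    have "H' \<subseteq> ?F"
      using H'(2) \<open>G \<subseteq> ?F\<close> es(2) set_take_subset[of "Suc t" es] by blast
    from copy_respects_classes[OF assms(1-3) H'(1) this] obtain A
      where A: "\<And>i. i \<in> {1..d} \<Longrightarrow> A i \<subseteq> {1..n i} \<and> card (A i) = r"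
        "H' = {e \<in> partial_transversals {1..d} A. card e = q}" by blast
    have "es ! t \<subseteq> Sigma {1..d} A"
      using A(2) H'(3) by (auto simp: partial_transversals_def)
    moreover have "e \<in> H'" if "e \<in> ?F" "e \<subseteq> Sigma {1..d} A" for e
      using that by (simp add: A(2) complete_partite_eq partial_transversals_def)
    ultimately show ?thesis
      using A(1) H'(2) by (intro exI[of _ A]) (simp add: valid_def subset_iff)
  next
    case False
    thus ?thesis using assms(4) by (intro exI[of _ "\<lambda>_. {1..r}"]) (auto simp: valid_def)
  qed
  then obtain A where A: "\<And>t. valid (A t)"
    "\<And>t. t < length es \<Longrightarrow> es ! t \<subseteq> Sigma {1..d} (A t)"
    "\<And>t e. t < length es \<Longrightarrow> e \<in> ?F \<Longrightarrow> e \<subseteq> Sigma {1..d} (A t) \<Longrightarrow> e \<in> G \<union> set (take (Suc t) es)"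
    by metis
  define v where "v t p = lagrange_weight (real ` A t (fst p)) (real (snd p))"
    for t and p :: "nat \<times> nat"
  define Z where "Z e t = (\<Prod>p\<in>e. v t p)" for e t
  have Z0: "Z e t = 0 \<longleftrightarrow> \<not> e \<subseteq> Sigma {1..d} (A t)" if "e \<in> ?F" for e t
  proof -
    have e: "e \<subseteq> (SIGMA i:{1..d}. {1..n i})" "finite e"
      using that by (auto simp: complete_partite_eq partial_transversals_def
          intro: finite_partial_transversal)
    have "v t p = 0 \<longleftrightarrow> p \<notin> Sigma {1..d} (A t)" if "p \<in> e" for p
    proof -
      have "fst p \<in> {1..d}" using that e by auto
      hence "finite (A t (fst p))"
        using A(1)[of t] finite_subset[OF _ finite_atLeastAtMost] unfolding valid_def by blast
      thus ?thesis using \<open>fst p \<in> {1..d}\<close>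
        by (cases p) (simp add: v_def lagrange_weight_eq_0_iff inj_image_mem_iff)
    qed
    thus ?thesis using e(2) by (auto simp: Z_def)
  qed
  have esF: "es ! j \<in> ?F" "es ! j \<notin> G" if "j < length es" for j
    using that es(2) nth_mem by blast+
  have "length es \<le> card (Z ` ?B)"
  proof (rule triangular_card_le[where z = "\<lambda>j. Z (es ! j)"])
    show "finite (Z ` ?B)"
      by (intro finite_imageI finite_subset[OF _ finite_partial_transversals]) auto
  next
    fix j assume j: "j < length es"
    show "Z (es ! j) j \<noteq> 0" using Z0[OF esF(1)[OF j]] A(2)[OF j] by simp
    have "(\<lambda>t. \<Prod>p\<in>es ! j. v t p) \<in> fun_space.span ((\<lambda>f t. \<Prod>p\<in>f. v t p) ` ?B)"
    proof (rule product_in_span[where L = "\<lambda>_. {1..r}"])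
      fix i x assume i: "i \<in> {1..d}" and x: "x \<in> {1..r}"
      let ?w = "lagrange_weight (real ` {1..r})"
      let ?b = "\<lambda>y. - (?w (real x) * (\<Prod>z\<in>real ` {1..r} - {real x}. y - z))"
      have "v t (i, x) = ?w (real x) + (\<Sum>y\<in>{r<..n i}. ?b (real y) * v t (i, y))" for t
      proof -
        have At: "A t i \<subseteq> {1..n i}" "card (A t i) = r" using A(1)[of t] i by (auto simp: valid_def)
        have "r \<le> n i" using assms(4) i by blast
        have diff: "real ` {1..n i} - real ` {1..r} = real ` {r<..n i}"
          using \<open>r \<le> n i\<close> by (subst image_set_diff[symmetric]) (auto intro!: arg_cong[of _ _ "(`) real"])
        have "lagrange_weight (real ` A t i) (real x) = ?w (real x) +
            (\<Sum>y\<in>real ` {1..n i} - real ` {1..r}. ?b y * lagrange_weight (real ` A t i) y)"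
          by (rule lagrange_weight_eliminate)
            (use At x \<open>r \<le> n i\<close> in \<open>auto simp: card_image intro!: image_mono\<close>)
        thus ?thesis
          unfolding diff by (simp add: v_def sum.reindex)
      qed
      thus "\<exists>a b. \<forall>t. v t (i, x) = a + (\<Sum>y\<in>{r<..n i}. b y * v t (i, y))"
        by (intro exI[of _ "?w (real x)"] exI[of _ "\<lambda>y. ?b (real y)"]) blast
    next
      have "{1..n i} \<subseteq> {1..r} \<union> {r<..n i}" for i by auto
      thus "es ! j \<in> partial_transversals {1..d} (\<lambda>i. {1..r} \<union> {r<..n i})" "card (es ! j) \<le> q"
        using esF(1)[OF j] by (auto simp: complete_partite_eq partial_transversals_def)
    qed auto
    thus "Z (es ! j) \<in> fun_space.span (Z ` ?B)" by (simp add: Z_def[abs_def])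
  next
    fix j t assume "t < j" "j < length es"
    hence "es ! j \<notin> set (take (Suc t) es)"
      using es(1) by (auto simp: set_conv_nth nth_eq_iff_index_eq)
    hence "\<not> es ! j \<subseteq> Sigma {1..d} (A t)"
      using A(3)[of t "es ! j"] esF[of j] \<open>t < j\<close> \<open>j < length es\<close> by auto
    thus "Z (es ! j) t = 0" using Z0 esF(1)[OF \<open>j < length es\<close>] by blast
  qed
  also have "\<dots> \<le> card ?B"
    by (intro card_image_le finite_subset[OF _ finite_partial_transversals]) auto
  finally show ?thesis using es by (metis distinct_card)
qed

section \<open>The construction\<close>

text \<open>
  The copy on the low vertices, with \<open>(i, r)\<close> replaced by the vertex of \<open>f\<close> in class \<open>i\<close> for every
  class that \<open>f\<close> meets. The replacement maps the edge of all \<open>(i, r)\<close> with \<open>i\<close> in \<open>fst ` f \<union> J\<close> to the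
  required edge.
\<close>

lemma copy_completing_edge:
  assumes "2 \<le> q" "q \<le> d" "1 \<le> r" "\<forall>i\<in>{1..d}. r \<le> n i"
    and f: "f \<in> partial_transversals {1..d} (\<lambda>i. {r<..n i})"
    and J: "J \<subseteq> {1..d} - fst ` f" "card J + card f = q"
  obtains H' where "is_copy (complete_balanced q r d) H'" "H' \<subseteq> complete_partite q d n"
    "f \<union> J \<times> {r} \<in> H'" "\<And>e. e \<in> H' \<Longrightarrow> {p \<in> e. r < snd p} \<subseteq> f"
proof -
  let ?H = "complete_balanced q r d" and ?V = "{1..d} \<times> {1..r}"
  have f': "f \<subseteq> (SIGMA i:{1..d}. {r<..n i})" "inj_on fst f"
    using f by (auto simp: partial_transversals_def)
  have finf: "finite f" using f by (rule finite_partial_transversal) simp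
  define g where "g p = (if snd p = r \<and> fst p \<in> fst ` f then inv_into f fst (fst p) else p)"
    for p :: "nat \<times> nat"
  have fst_g [simp]: "fst (g p) = fst p" for p
    by (auto simp: g_def f_inv_into_f)
  have g_in: "g p \<in> f" if "snd p = r" "fst p \<in> fst ` f" for p
    using that by (auto simp: g_def intro: inv_into_into)
  have g_id: "g p = p" if "\<not> (snd p = r \<and> fst p \<in> fst ` f)" for p
    using that unfolding g_def by (rule if_not_P)
  have g_range: "g p \<in> f \<union> ?V" if "p \<in> ?V" for p
    using that g_in[of p] g_id[of p] by (cases "snd p = r \<and> fst p \<in> fst ` f") auto
  have high: "r < snd p" if "p \<in> f" for p using that f' by auto
  have "inj_on g ?V"
  proof (rule inj_onI)
    fix u v assume uv: "u \<in> ?V" "v \<in> ?V" "g u = g v"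
    have fst: "fst u = fst v" using uv(3) fst_g by metis
    show "u = v"
    proof (cases "snd u = r \<and> fst u \<in> fst ` f"; cases "snd v = r \<and> fst v \<in> fst ` f")
      assume "snd u = r \<and> fst u \<in> fst ` f" "snd v = r \<and> fst v \<in> fst ` f"
      thus ?thesis using fst by (simp add: prod_eq_iff)
    next
      assume "snd u = r \<and> fst u \<in> fst ` f" "\<not> (snd v = r \<and> fst v \<in> fst ` f)"
      hence "r < snd v" using high g_in g_id uv by metis
      thus ?thesis using uv by auto
    next
      assume "\<not> (snd u = r \<and> fst u \<in> fst ` f)" "snd v = r \<and> fst v \<in> fst ` f"
      hence "r < snd u" using high g_in g_id uv by metis
      thus ?thesis using uv by auto
    next
      assume "\<not> (snd u = r \<and> fst u \<in> fst ` f)" "\<not> (snd v = r \<and> fst v \<in> fst ` f)"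
      thus ?thesis using g_id uv by metis
    qed
  qed
  define H' where "H' = (\<lambda>e. g ` e) ` ?H"
  have "is_copy ?H H'"
    using \<open>inj_on g ?V\<close> Union_complete_balanced[OF assms(1,2), of r]
    by (auto simp: is_copy_def H'_def)
  moreover have "H' \<subseteq> complete_partite q d n"
  proof
    fix e' assume "e' \<in> H'"
    then obtain e where e: "e \<in> ?H" "e' = g ` e" by (auto simp: H'_def)
    hence eV: "e \<subseteq> ?V" and inj: "inj_on fst e" and card: "card e = q"
      by (auto simp: complete_balanced_def complete_partite_eq partial_transversals_def)
    have "f \<union> ?V \<subseteq> (SIGMA i:{1..d}. {1..n i})"
      using f' assms(4) by fastforce
    hence "e' \<subseteq> (SIGMA i:{1..d}. {1..n i})"
      using e eV g_range by blast
    moreover have "inj_on fst e'"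
      using inj by (auto simp: e inj_on_def)
    moreover have "card e' = q"
      using card eV \<open>inj_on g ?V\<close> e by (metis card_image inj_on_subset)
    ultimately show "e' \<in> complete_partite q d n"
      by (simp add: complete_partite_eq partial_transversals_def)
  qed
  moreover have "f \<union> J \<times> {r} \<in> H'"
  proof -
    let ?e = "(fst ` f \<union> J) \<times> {r}"
    have "finite J" using J by (auto intro: finite_subset)
    hence "card (fst ` f \<union> J) = q"
      using J finf f' by (subst card_Un_disjoint) (auto simp: card_image)
    hence "card ?e = q" by (simp add: card_cartesian_product)
    moreover have "?e \<subseteq> ?V" using f' J assms(3) by auto
    ultimately have "?e \<in> ?H"
      by (auto simp: complete_balanced_def complete_partite_eq partial_transversals_def inj_on_def)
    moreover have "g ` ?e = f \<union> J \<times> {r}"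
    proof -
      have "g (fst p, r) = p" if "p \<in> f" for p
        using g_in[of "(fst p, r)"] fst_g[of "(fst p, r)"] f'(2) that
        by (metis fst_conv image_eqI inj_onD snd_conv)
      hence "(\<lambda>i. g (i, r)) ` fst ` f = f" by (simp add: image_image)
      moreover have "(\<lambda>i. g (i, r)) ` J = J \<times> {r}"
      proof -
        have "g (i, r) = (i, r)" if "i \<in> J" for i using that J(1) by (intro g_id) auto
        thus ?thesis by auto
      qed
      moreover have "?e = (\<lambda>i. (i, r)) ` (fst ` f \<union> J)" by auto
      ultimately show ?thesis by (simp add: image_image image_Un)
    qed
    ultimately show ?thesis unfolding H'_def by (metis image_eqI)
  qed
  moreover have "{p \<in> e'. r < snd p} \<subseteq> f" if e': "e' \<in> H'" for e'
  proof
    fix p assume p: "p \<in> {p \<in> e'. r < snd p}"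
    obtain e where e: "e \<in> ?H" "e' = g ` e" using e' unfolding H'_def by blast
    hence "e \<subseteq> ?V" using Union_complete_balanced[OF assms(1,2), of r] by blast
    hence "e' \<subseteq> f \<union> ?V" using g_range e(2) by blast
    thus "p \<in> f" using p by auto
  qed
  ultimately show ?thesis by (rule that)
qed

text \<open>
  The removed edges correspond to the partial transversals \<open>f\<close> of high vertices, and \<open>f\<close> is recovered
  from its edge as the set of high vertices. By the previous lemma the edge of \<open>f\<close> completes a copy
  in which any other removed edge comes from a proper subset of \<open>f\<close>, hence from a smaller one. So
  it suffices to sort by size.
\<close>

lemma exists_weakly_saturated:
  assumes "2 \<le> q" "q \<le> d" "1 \<le> r" "\<forall>i\<in>{1..d}. r \<le> n i"
  obtains G where "weakly_saturated (complete_partite q d n) (complete_balanced q r d) G"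
    "card (complete_partite q d n - G) =
      card {f \<in> partial_transversals {1..d} (\<lambda>i. {r<..n i}). card f \<le> q}"
proof -
  let ?F = "complete_partite q d n" and ?H = "complete_balanced q r d"
  define B where "B = {f \<in> partial_transversals {1..d} (\<lambda>i. {r<..n i}). card f \<le> q}"
  have "\<forall>f\<in>B. \<exists>J. J \<subseteq> {1..d} - fst ` f \<and> card J + card f = q"
  proof
    fix f assume "f \<in> B"
    hence f: "f \<subseteq> (SIGMA i:{1..d}. {r<..n i})" "inj_on fst f" "card f \<le> q"
      by (auto simp: B_def partial_transversals_def)
    have "fst ` f \<subseteq> {1..d}" using f by auto
    hence "q - card f \<le> card ({1..d} - fst ` f)"
      using f assms(2) by (simp add: card_Diff_subset finite_subset card_image)
    then obtain J where "J \<subseteq> {1..d} - fst ` f" "card J = q - card f"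
      by (metis obtain_subset_with_card_n)
    thus "\<exists>J. J \<subseteq> {1..d} - fst ` f \<and> card J + card f = q"
      using f(3) by (intro exI[of _ J]) simp
  qed
  from bchoice[OF this] obtain J
    where J: "\<And>f. f \<in> B \<Longrightarrow> J f \<subseteq> {1..d} - fst ` f \<and> card (J f) + card f = q"
    by blast
  define fill where "fill f = f \<union> J f \<times> {r}" for f
  have high: "{p \<in> fill f. r < snd p} = f" if "f \<in> B" for f
    using that by (auto simp: fill_def B_def partial_transversals_def)
  have inj: "inj_on fill B" using high by (rule inj_on_inverseI)
  have copy: "\<exists>H'. is_copy ?H H' \<and> H' \<subseteq> ?F \<and> fill f \<in> H' \<and> (\<forall>e\<in>H'. {p \<in> e. r < snd p} \<subseteq> f)"
    if "f \<in> B" for f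
  proof -
    have f: "f \<in> partial_transversals {1..d} (\<lambda>i. {r<..n i})" using that by (simp add: B_def)
    have Jf: "J f \<subseteq> {1..d} - fst ` f" "card (J f) + card f = q" using J[OF that] by auto
    obtain H' where "is_copy ?H H'" "H' \<subseteq> ?F" "f \<union> J f \<times> {r} \<in> H'"
      "\<And>e. e \<in> H' \<Longrightarrow> {p \<in> e. r < snd p} \<subseteq> f"
      using copy_completing_edge[OF assms f Jf] by blast
    thus ?thesis unfolding fill_def by blast
  qed
  define G where "G = ?F - fill ` B"
  have diff: "?F - G = fill ` B" using copy by (auto simp: G_def)
  have finB: "finite B"
    unfolding B_def by (intro finite_subset[OF _ finite_partial_transversals]) auto
  then obtain fs0 where fs0: "set fs0 = B" "distinct fs0"
    using finite_distinct_list by blast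
  define fs where "fs = sort_key card fs0"
  have fs: "set fs = B" "distinct fs" "sorted (map card fs)"
    using fs0 by (auto simp: fs_def)
  have "weakly_saturated ?F ?H G"
    unfolding weakly_saturated_def
  proof (intro conjI exI[of _ "map fill fs"] allI impI)
    show "G \<subseteq> ?F" by (auto simp: G_def)
    show "distinct (map fill fs)" using fs inj by (simp add: distinct_map)
    show "set (map fill fs) = ?F - G" using fs diff by simp
  next
    fix t assume "t < length (map fill fs)"
    hence t: "t < length fs" by simp
    hence ft: "fs ! t \<in> B" using fs nth_mem by blast
    from copy[OF this] obtain H' where H': "is_copy ?H H'" "H' \<subseteq> ?F" "fill (fs ! t) \<in> H'"
      "\<And>e. e \<in> H' \<Longrightarrow> {p \<in> e. r < snd p} \<subseteq> fs ! t" by blast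
    have "H' \<subseteq> G \<union> set (take (Suc t) (map fill fs))"
    proof
      fix e assume e: "e \<in> H'"
      show "e \<in> G \<union> set (take (Suc t) (map fill fs))"
      proof (cases "e \<in> G")
        case False
        hence "e \<in> fill ` B" using e H'(2) diff by blast
        then obtain s where s: "s < length fs" "e = fill (fs ! s)"
          using fs(1) by (metis imageE in_set_conv_nth)
        hence sub: "fs ! s \<subseteq> fs ! t"
          using H'(4)[OF e] high fs(1) by (metis nth_mem)
        have fin: "finite (fs ! t)"
          using ft by (auto simp: B_def intro: finite_partial_transversal)
        \<comment> \<open>Otherwise the sorting makes \<open>fs ! s\<close> at least as large as \<open>fs ! t\<close>; being a subset, it
          would be equal, against distinctness.\<close>
        have "s \<le> t"
        proof (rule ccontr)
          assume "\<not> s \<le> t"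
          hence "card (fs ! t) \<le> card (fs ! s)"
            using fs(3) s(1) t by (metis sorted_nth_mono length_map nat_le_linear nth_map)
          hence "fs ! s = fs ! t" using sub fin by (simp add: card_seteq)
          thus False using fs(2) s t \<open>\<not> s \<le> t\<close> by (simp add: nth_eq_iff_index_eq)
        qed
        hence "take (Suc t) (map fill fs) ! s = e" "s < length (take (Suc t) (map fill fs))"
          using s t by auto
        thus ?thesis by (metis UnI2 nth_mem)
      qed simp
    qed
    thus "\<exists>H'. is_copy ?H H' \<and> H' \<subseteq> G \<union> set (take (Suc t) (map fill fs)) \<and> map fill fs ! t \<in> H'"
      using H' t by auto
  qed
  moreover have "card (?F - G) = card B"
    using diff inj by (simp add: card_image)
  ultimately show ?thesis by (intro that) (simp_all add: B_def)
qed

theorem corollary1p2: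
  fixes d q r :: nat and n :: "nat \<Rightarrow> nat"
  assumes "2 \<le> q" and "q \<le> d" and "1 \<le> r" and "\<forall>i\<in>{1..d}. r \<le> n i"
  shows "int (wsat (complete_partite q d n) (complete_balanced q r d)) =
    (\<Sum>I | I \<subseteq> {1..d} \<and> card I = q. \<Prod>i\<in>I. int (n i)) -
    (\<Sum>I | I \<subseteq> {1..d} \<and> card I \<le> q. \<Prod>i\<in>I. (int (n i) - int r))"
proof -
  let ?F = "complete_partite q d n" and ?H = "complete_balanced q r d"
  let ?B = "{f \<in> partial_transversals {1..d} (\<lambda>i. {r<..n i}). card f \<le> q}"
  have finF: "finite ?F"
    unfolding complete_partite_eq by (intro finite_subset[OF _ finite_partial_transversals]) auto
  have card_split: "card G + card (?F - G) = card ?F" if "weakly_saturated ?F ?H G" for G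
  proof -
    have "G \<subseteq> ?F" using that by (simp add: weakly_saturated_def)
    thus ?thesis using finF by (simp add: card_Diff_subset card_mono finite_subset)
  qed
  obtain G where G: "weakly_saturated ?F ?H G" "card (?F - G) = card ?B"
    using exists_weakly_saturated[OF assms] by blast
  have "wsat ?F ?H = card G"
    unfolding wsat_def
  proof (rule Least_equality)
    show "\<exists>G'. weakly_saturated ?F ?H G' \<and> card G' = card G" using G(1) by blast
    fix m assume "\<exists>G'. weakly_saturated ?F ?H G' \<and> card G' = m"
    then obtain G' where G': "weakly_saturated ?F ?H G'" "card G' = m" by blast
    show "card G \<le> m"
      using card_complement_le[OF assms G'(1)] card_split[OF G'(1)] card_split[OF G(1)] G(2) G'(2)
      by linarith
  qed
  hence "int (wsat ?F ?H) = int (card ?F) - int (card ?B)"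
    using card_split[OF G(1)] G(2) by linarith
  also have "int (card ?F) = (\<Sum>I | I \<subseteq> {1..d} \<and> card I = q. \<Prod>i\<in>I. int (n i))"
    unfolding complete_partite_eq by (subst card_partial_transversals) auto
  also have "int (card ?B) = (\<Sum>I | I \<subseteq> {1..d} \<and> card I \<le> q. \<Prod>i\<in>I. int (n i) - int r)"
  proof -
    have "int (card ?B) = (\<Sum>I | I \<subseteq> {1..d} \<and> card I \<le> q. \<Prod>i\<in>I. int (n i - r))"
      by (subst card_partial_transversals) auto
    also have "\<dots> = (\<Sum>I | I \<subseteq> {1..d} \<and> card I \<le> q. \<Prod>i\<in>I. int (n i) - int r)"
      by (intro sum.cong prod.cong) (use assms(4) in \<open>auto simp: of_nat_diff\<close>)
    finally show ?thesis .
  qed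
  finally show ?thesis .
qed

end
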